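(* Let $(X,S)$ be a subshift with $X \subseteq \{0,1\}^{\mathbb{Z}}$. For $n \ge 1$ let $$a(n) = \min_{w \in \mathcal{L}_n(X)} |w|_0, \qquad b(n) = \max_{w \in \mathcal{L}_n(X)} |w|_0 .$$ Suppose that $(X,S)$ is minimal and topologically mixing. Then $$\lim_{n \to +\infty} \big(b(n) - a(n)\big) = +\infty.$$
   Context: $S$ is the shift map on $\{0,1\}^{\mathbb{Z}}$, $S((x_n)_{n\in\mathbb{Z}}) = (x_{n+1})_{n\in\mathbb{Z}}$, and a subshift $(X,S)$ is given by a closed $S$-invariant subset $X$ of $\{0,1\}^{\mathbb{Z}}$ (with the product topology). $\mathcal{L}_n(X)$ is the set of words of length $n$ occurring in points of $X$, and $|w|_0$ is the number of occurrences of the letter $0$ in the word $w$. A topological dynamical system $(X,T)$ (a compact metric space $X$ with a homeomorphism $T : X \to X$) is minimal if the orbit $\{T^n x : n \in \mathbb{Z}\}$ of every point $x \in X$ is dense in $X$. It is topologically mixing if for any nonempty open sets $U,V \subseteq X$ there exists $N \in \mathbb{N}$ such that $T^n U \cap V \neq \emptyset$ for all $n \ge N$.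
   Formalization: The subshift X is assumed nonempty (so that min and max exist) and not a single point: the one-point subshifts {0^Z} and {1^Z} are minimal and topologically mixing but have b(n) = a(n) for all n. *)

theory Defs
  imports "HOL-Analysis.Analysis"
begin

text \<open>
  Two-sided sequences have type \<open>int \<Rightarrow> nat\<close>, with the product topology provided by
  HOL-Analysis (\<open>nat\<close> is discrete); a system \<open>(X, T)\<close> is a carrier set \<open>X\<close> with the
  subspace topology and a map \<open>T\<close> whose behaviour only matters on \<open>X\<close>.
\<close>

definition shift :: "(int \<Rightarrow> 'a) \<Rightarrow> int \<Rightarrow> 'a" where
  "shift x = (\<lambda>n. x (n + 1))"

text \<open>
  Invariance is \<open>shift ` X = X\<close>, so that the shift restricts to a homeomorphism of \<open>X\<close>.
\<close>

definition subshift :: "(int \<Rightarrow> nat) set \<Rightarrow> bool" where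
  "subshift X \<longleftrightarrow> X \<subseteq> UNIV \<rightarrow> {0, 1} \<and> closed X \<and> shift ` X = X"

text \<open>Integer powers of a bijection \<open>T\<close> of \<open>X\<close>.\<close>

definition ipow :: "'a set \<Rightarrow> ('a \<Rightarrow> 'a) \<Rightarrow> int \<Rightarrow> 'a \<Rightarrow> 'a" where
  "ipow X T n = (if n \<ge> 0 then T ^^ nat n else inv_into X T ^^ nat (- n))"

definition orbit :: "'a set \<Rightarrow> ('a \<Rightarrow> 'a) \<Rightarrow> 'a \<Rightarrow> 'a set" where
  "orbit X T x = range (\<lambda>n. ipow X T n x)"

definition minimal_system :: "'a::topological_space set \<Rightarrow> ('a \<Rightarrow> 'a) \<Rightarrow> bool" where
  "minimal_system X T \<longleftrightarrow> (\<forall>x\<in>X. X \<subseteq> closure (orbit X T x))"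

definition topologically_mixing :: "'a::topological_space set \<Rightarrow> ('a \<Rightarrow> 'a) \<Rightarrow> bool" where
  "topologically_mixing X T \<longleftrightarrow>
     (\<forall>U V. openin (top_of_set X) U \<longrightarrow> openin (top_of_set X) V \<longrightarrow> U \<noteq> {} \<longrightarrow> V \<noteq> {} \<longrightarrow>
        (\<exists>N. \<forall>n\<ge>N. (T ^^ n) ` U \<inter> V \<noteq> {}))"

definition language :: "(int \<Rightarrow> 'a) set \<Rightarrow> nat \<Rightarrow> 'a list set" where
  "language X n = {map (\<lambda>k. x (i + int k)) [0..<n] | x i. x \<in> X}"

definition min_zeros :: "(int \<Rightarrow> nat) set \<Rightarrow> nat \<Rightarrow> nat" where
  "min_zeros X n = Min ((\<lambda>w. count_list w 0) ` language X n)"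

definition max_zeros :: "(int \<Rightarrow> nat) set \<Rightarrow> nat \<Rightarrow> nat" where
  "max_zeros X n = Max ((\<lambda>w. count_list w 0) ` language X n)"

end

theory Submission
  imports Defs
begin

text \<open>
  Write \<open>d n = b n - a n\<close>. If \<open>x\<close> shows a word with \<open>a m\<close> zeros at position \<open>0\<close> and a word
  with \<open>b m\<close> zeros at position \<open>n\<close>, then the windows of length \<open>n\<close> starting at \<open>0\<close> and at \<open>m\<close>
  differ in their number of zeros by exactly \<open>d m\<close>. Mixing provides such \<open>x\<close> for all large \<open>n\<close>,
  so \<open>d m \<le> d n\<close> for all large \<open>n\<close>, and it is enough to show that \<open>d\<close> is unbounded.

  If \<open>d\<close> were bounded, choose \<open>m\<close> with \<open>d m\<close> maximal; in the situation above the window of \<open>x\<close>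
  of length \<open>n\<close> at \<open>0\<close> then has exactly \<open>a n\<close> zeros. Letting the second word occur at \<open>n\<close> and
  again at \<open>n + q\<close>, one finds that \<open>a (n + q) - a n\<close> is eventually constant for every large \<open>q\<close>.
  Comparing \<open>q\<close> and \<open>q + 1\<close>, so is \<open>a (n + 1) - a n\<close>, whose eventual value must be \<open>0\<close> or \<open>1\<close>.
  Hence the number of zeros, or the number of ones, in a word is bounded, whereas by mixing every
  letter that occurs in \<open>X\<close> occurs arbitrarily often in suitable words.
\<close>

section \<open>Words and cylinder sets\<close>

definition word :: "(int \<Rightarrow> 'a) \<Rightarrow> int \<Rightarrow> nat \<Rightarrow> 'a list" where
  "word x i n = map (\<lambda>k. x (i + int k)) [0..<n]"

lemma length_word [simp]: "length (word x i n) = n"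
  by (simp add: word_def)

lemma word_add: "word x i (n + m) = word x i n @ word x (i + int n) m"
  by (rule nth_equalityI) (auto simp: word_def nth_append)

lemma word_translate: "word (\<lambda>j. x (j + k)) i n = word x (i + k) n"
  by (simp add: word_def algebra_simps)

lemma language_eq: "language X n = {word x i n | x i. x \<in> X}"
  by (simp add: language_def word_def)

lemma shift_funpow: "(shift ^^ n) x = (\<lambda>j. x (j + int n))"
  by (induction n) (auto simp: shift_def algebra_simps)

lemma open_cylinder: "open {z :: int \<Rightarrow> nat. word z i n = w}"
proof (cases "length w = n")
  case True
  have "open {z :: int \<Rightarrow> nat. z j = c}" for j c
  proof -
    have "open ((\<lambda>z :: int \<Rightarrow> nat. z j) -` {c})"
      by (intro open_vimage open_discrete) simp
    then show ?thesis
      by (simp add: vimage_def)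
  qed
  then have "open (\<Inter>k\<in>{..<n}. {z :: int \<Rightarrow> nat. z (i + int k) = w ! k})"
    by (intro open_INT) auto
  also have "(\<Inter>k\<in>{..<n}. {z. z (i + int k) = w ! k}) = {z. word z i n = w}"
    using True by (auto simp: word_def list_eq_iff_nth_eq)
  finally show ?thesis .
next
  case False
  then have "{z :: int \<Rightarrow> nat. word z i n = w} = {}"
    by auto
  then show ?thesis
    by simp
qed

lemma count_list_binary:
  "set w \<subseteq> {0, 1} \<Longrightarrow> count_list w (0::nat) + count_list w 1 = length w"
  by (induction w) auto

section \<open>Language and zero counts of a mixing subshift\<close>

locale mixing_subshift =
  fixes X :: "(int \<Rightarrow> nat) set"
  assumes subshift: "subshift X"
    and nonempty: "X \<noteq> {}"
    and mixing: "topologically_mixing X shift"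
begin

lemma translate_mem:
  assumes "x \<in> X"
  shows "(\<lambda>j. x (j + k)) \<in> X"
proof -
  have img: "shift ` X = X"
    using subshift by (simp add: subshift_def)
  have fwd: "(\<lambda>j. y (j + int n)) \<in> X" if "y \<in> X" for y n
  proof -
    have "(shift ^^ n) y \<in> X"
      using that img by (induction n) auto
    then show ?thesis
      by (simp add: shift_funpow)
  qed
  \<comment> \<open>Negative translates come from surjectivity of the shift on \<open>X\<close>:
    \<open>x\<close> has an \<open>n\<close>-th preimage in \<open>X\<close>.\<close>
  have bwd: "\<exists>y\<in>X. x = (\<lambda>j. y (j + int n))" for n
  proof -
    have "\<exists>y\<in>X. x = (shift ^^ n) y"
    proof (induction n)
      case 0
      then show ?case using assms by auto
    next
      case (Suc n)
      then obtain y where "y \<in> X" "x = (shift ^^ n) y" by blast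
      moreover obtain z where "z \<in> X" "y = shift z" using \<open>y \<in> X\<close> img by blast
      ultimately show ?case by (metis comp_apply funpow_Suc_right)
    qed
    then show ?thesis
      by (simp add: shift_funpow)
  qed
  show ?thesis
  proof (cases "k \<ge> 0")
    case True
    then show ?thesis using fwd[OF assms, of "nat k"] by simp
  next
    case False
    obtain y where "y \<in> X" "x = (\<lambda>j. y (j + int (nat (- k))))"
      using bwd by blast
    then show ?thesis
      using False by simp
  qed
qed

lemma language_from_0: "language X n = (\<lambda>x. word x 0 n) ` X"
proof -
  have "word x i n \<in> (\<lambda>x. word x 0 n) ` X" if "x \<in> X" for x i
    using imageI[OF translate_mem[OF that, of i], of "\<lambda>x. word x 0 n"]
    by (simp add: word_translate)
  then show ?thesis
    unfolding language_eq by blast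
qed

lemma word_in_language: "x \<in> X \<Longrightarrow> word x i n \<in> language X n"
  by (auto simp: language_eq)

lemma letter_binary: "x \<in> X \<Longrightarrow> x i = 0 \<or> x i = 1"
  using subshift by (auto simp: subshift_def Pi_iff)

lemma language_binary: "w \<in> language X n \<Longrightarrow> set w \<subseteq> {0, 1} \<and> length w = n"
proof -
  assume "w \<in> language X n"
  then obtain x i where x: "x \<in> X" "w = word x i n"
    by (auto simp: language_eq)
  then have "x j \<in> {0, 1}" for j
    using letter_binary by blast
  then have "set w \<subseteq> {0, 1}"
    unfolding x(2) word_def set_map by (intro image_subsetI)
  then show ?thesis
    using x(2) by simp
qed

lemma finite_language: "finite (language X n)"
  by (rule finite_subset[OF _ finite_lists_length_eq[of "{0, 1}" n]])
    (use language_binary in auto)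

lemma language_nonempty: "language X n \<noteq> {}"
  using nonempty by (simp add: language_from_0)

lemma count_bounds:
  assumes "x \<in> X"
  shows "min_zeros X n \<le> count_list (word x i n) 0" "count_list (word x i n) 0 \<le> max_zeros X n"
  using word_in_language[OF assms] finite_language by (auto simp: min_zeros_def max_zeros_def)

lemma min_zeros_attained: "\<exists>u\<in>language X n. count_list u 0 = min_zeros X n"
proof -
  have "min_zeros X n \<in> (\<lambda>w. count_list w 0) ` language X n"
    unfolding min_zeros_def using finite_language language_nonempty by (intro Min_in) auto
  then show ?thesis
    by force
qed

lemma max_zeros_attained: "\<exists>v\<in>language X n. count_list v 0 = max_zeros X n"
proof -
  have "max_zeros X n \<in> (\<lambda>w. count_list w 0) ` language X n"
    unfolding max_zeros_def using finite_language language_nonempty by (intro Max_in) auto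
  then show ?thesis
    by force
qed

lemma min_zeros_le_max_zeros: "min_zeros X n \<le> max_zeros X n"
  using nonempty count_bounds by (meson all_not_in_conv order_trans)

lemma min_zeros_le: "min_zeros X n \<le> n"
  by (metis min_zeros_attained language_binary count_le_length)

text \<open>Mixing is applied to the cylinders of \<open>u\<close> and \<open>v\<close> at the
  origin, which are nonempty because any occurrence of a word can be translated to position
  \<open>0\<close>.\<close>

lemma mixing_words:
  assumes "u \<in> language X n" "v \<in> language X m"
  obtains N where "\<And>p. p \<ge> N \<Longrightarrow> \<exists>x\<in>X. word x 0 n = u \<and> word x (int p) m = v"
proof -
  let ?C = "\<lambda>n w. X \<inter> {z. word z 0 n = w}"
  have "?C n u \<noteq> {}" "?C m v \<noteq> {}"
    using assms by (auto simp: language_from_0)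
  moreover have "openin (top_of_set X) (?C n u)" "openin (top_of_set X) (?C m v)"
    by (auto intro: openin_open_Int open_cylinder)
  ultimately have "\<exists>N. \<forall>p\<ge>N. (shift ^^ p) ` ?C n u \<inter> ?C m v \<noteq> {}"
    by - (rule mixing[unfolded topologically_mixing_def, rule_format])
  then obtain N where N: "\<And>p. p \<ge> N \<Longrightarrow> (shift ^^ p) ` ?C n u \<inter> ?C m v \<noteq> {}"
    by blast
  have "\<exists>x\<in>X. word x 0 n = u \<and> word x (int p) m = v" if "p \<ge> N" for p
  proof -
    from N[OF that] obtain x where "x \<in> X" "word x 0 n = u" "word ((shift ^^ p) x) 0 m = v"
      by auto
    then show ?thesis
      by (auto simp: shift_funpow word_translate)
  qed
  then show ?thesis
    using that by blast
qed

section \<open>Comparing zero counts of overlapping windows\<close>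

lemma count_exchange:
  "count_list (word x 0 n) e + count_list (word x (int n) m) e
   = count_list (word x 0 m) e + count_list (word x (int m) n) e"
proof -
  \<comment> \<open>Both sides are the window of length \<open>n + m\<close> at \<open>0\<close>,
    cut after \<open>n\<close> and after \<open>m\<close> letters.\<close>
  have "word x 0 n @ word x (int n) m = word x 0 m @ word x (int m) n"
    using word_add[of x 0 n m] word_add[of x 0 m n] by (simp add: add.commute)
  then show ?thesis
    by (metis count_list_append)
qed

lemma eventually_spread_ge:
  "\<forall>\<^sub>F n in sequentially. max_zeros X m - min_zeros X m \<le> max_zeros X n - min_zeros X n"
proof -
  obtain u where u: "u \<in> language X m" "count_list u 0 = min_zeros X m"
    using min_zeros_attained by blast
  obtain v where v: "v \<in> language X m" "count_list v 0 = max_zeros X m"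
    using max_zeros_attained by blast
  obtain N where N: "\<And>p. p \<ge> N \<Longrightarrow> \<exists>x\<in>X. word x 0 m = u \<and> word x (int p) m = v"
    using mixing_words[OF u(1) v(1)] by blast
  have "max_zeros X m - min_zeros X m \<le> max_zeros X n - min_zeros X n" if "n \<ge> N" for n
  proof -
    from N[OF that] obtain x where x: "x \<in> X" "word x 0 m = u" "word x (int n) m = v"
      by blast
    then have "count_list (word x 0 m) 0 = min_zeros X m"
      "count_list (word x (int n) m) 0 = max_zeros X m"
      using u(2) v(2) by auto
    then show ?thesis
      using count_exchange[of x n 0 m] count_bounds(1)[OF x(1), of n 0]
        count_bounds(2)[OF x(1), of "int m" n]
      by linarith
  qed
  then show ?thesis
    by (auto simp: eventually_sequentially)
qed

text \<open>By \<open>count_exchange\<close> the window at \<open>0\<close> has \<open>d m\<close>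
  fewer zeros than the one at \<open>m\<close>, hence at most \<open>b n - d m\<close>. Since
  \<open>d n \<le> d m\<close>, this is at most \<open>a n\<close>.\<close>

lemma count_eq_min_zeros:
  assumes max: "max_zeros X n - min_zeros X n \<le> max_zeros X m - min_zeros X m"
    and x: "x \<in> X" "count_list (word x 0 m) 0 = min_zeros X m"
      "count_list (word x (int n) m) 0 = max_zeros X m"
  shows "count_list (word x 0 n) 0 = min_zeros X n"
  using count_exchange[of x n 0 m] count_bounds(1)[OF x(1), of n 0]
    count_bounds(2)[OF x(1), of "int m" n] min_zeros_le_max_zeros[of n]
    min_zeros_le_max_zeros[of m] x max by linarith

lemma min_zeros_eventually_linear:
  assumes max: "\<And>n. max_zeros X n - min_zeros X n \<le> max_zeros X m - min_zeros X m"
  obtains c :: int and N where "\<And>k. int (min_zeros X (N + k)) = int (min_zeros X N) + int k * c"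
proof -
  obtain u where u: "u \<in> language X m" "count_list u 0 = min_zeros X m"
    using min_zeros_attained by blast
  obtain v where v: "v \<in> language X m" "count_list v 0 = max_zeros X m"
    using max_zeros_attained by blast
  obtain Q where Q: "\<And>p. p \<ge> Q \<Longrightarrow> \<exists>x\<in>X. word x 0 m = v \<and> word x (int p) m = v"
    using mixing_words[OF v(1) v(1)] by blast
  \<comment> \<open>The increment \<open>t\<close> is the number of zeros in the first
    \<open>q\<close> letters of a point \<open>y\<close> showing \<open>v\<close> at
    \<open>0\<close> and at \<open>q\<close>. A point showing \<open>u\<close> at \<open>0\<close>
    and the word of \<open>y\<close> of length \<open>q + m\<close> at \<open>n\<close> has
    \<open>v\<close> at both \<open>n\<close> and \<open>n + q\<close>, so its windows of lengths
    \<open>n\<close> and \<open>n + q\<close> at \<open>0\<close> are both minimal.\<close>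
  have step: "\<exists>t N. \<forall>n\<ge>N. min_zeros X (n + q) = min_zeros X n + t" if "q \<ge> Q" for q
  proof -
    from Q[OF that] obtain y where y: "y \<in> X" "word y 0 m = v" "word y (int q) m = v"
      by blast
    obtain N where N: "\<And>p. p \<ge> N \<Longrightarrow>
        \<exists>x\<in>X. word x 0 m = u \<and> word x (int p) (q + m) = word y 0 (q + m)"
      using mixing_words[OF u(1) word_in_language[OF y(1)]] by blast
    have "min_zeros X (n + q) = min_zeros X n + count_list (word y 0 q) 0" if "n \<ge> N" for n
    proof -
      from N[OF that] obtain x where x: "x \<in> X" "word x 0 m = u" "word x (int n) (q + m) = word y 0 (q + m)"
        by blast
      have xq: "word x (int n) q = word y 0 q" "word x (int (n + q)) m = v"
        using x(3) y(3) by (simp_all add: word_add)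
      have "word x (int n) (m + q) = word y 0 (m + q)"
        using x(3) by (simp add: add.commute)
      then have xn: "word x (int n) m = v"
        using y(2) by (simp add: word_add)
      have "count_list (word x 0 n) 0 = min_zeros X n"
        using count_eq_min_zeros[OF max x(1)] x(2) xn u v by simp
      moreover have "count_list (word x 0 (n + q)) 0 = min_zeros X (n + q)"
        using count_eq_min_zeros[OF max x(1)] x(2) xq(2) u v by simp
      ultimately show ?thesis
        using xq(1) by (simp add: word_add)
    qed
    then show ?thesis by blast
  qed
  obtain t N where t: "\<And>n. n \<ge> N \<Longrightarrow> min_zeros X (n + Q) = min_zeros X n + t"
    using step[of Q] by auto
  obtain t' N' where t': "\<And>n. n \<ge> N' \<Longrightarrow> min_zeros X (n + Suc Q) = min_zeros X n + t'"
    using step[of "Suc Q"] by auto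
  \<comment> \<open>For \<open>n \<ge> M\<close>, both recurrences hold at \<open>k = n - Q\<close>;
    subtracting them gives the slope \<open>t' - t\<close>.\<close>
  define M where "M = N + N' + Q"
  have slope: "int (min_zeros X (Suc n)) = int (min_zeros X n) + (int t' - int t)" if "n \<ge> M" for n
  proof -
    define k where "k = n - Q"
    have "n = k + Q" "k \<ge> N" "k \<ge> N'"
      using that by (auto simp: k_def M_def)
    then show ?thesis
      using t[of k] t'[of k] by simp
  qed
  have "int (min_zeros X (M + k)) = int (min_zeros X M) + int k * (int t' - int t)" for k
  proof (induction k)
    case (Suc k)
    then show ?case
      using slope[of "M + k"] by (simp add: algebra_simps)
  qed simp
  then show ?thesis
    using that by blast
qed

section \<open>Unboundedness of the spread\<close>

lemma letter_count_unbounded: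
  assumes "x \<in> X" "x i = e"
  shows "\<exists>y\<in>X. \<exists>n. k \<le> count_list (word y 0 n) e"
proof (induction k)
  case 0
  then show ?case using nonempty by auto
next
  case (Suc k)
  then obtain y n where y: "y \<in> X" "k \<le> count_list (word y 0 n) e" by blast
  have "[e] \<in> language X 1"
    using word_in_language[OF assms(1), of i 1] assms(2) by (simp add: word_def)
  then obtain N where N: "\<And>p. p \<ge> N \<Longrightarrow>
      \<exists>z\<in>X. word z 0 n = word y 0 n \<and> word z (int p) 1 = [e]"
    using mixing_words[OF word_in_language[OF y(1)]] by blast
  \<comment> \<open>Position \<open>n + N\<close> is beyond both the mixing threshold and the end of
    the old word, so the new \<open>e\<close> is counted separately.\<close>
  obtain z where z: "z \<in> X" "word z 0 n = word y 0 n" "word z (int (n + N)) 1 = [e]"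
    using N[of "n + N"] by auto
  have "word z 0 (n + N + 1) = word y 0 n @ word z (int n) N @ [e]"
    using z by (simp add: word_add del: One_nat_def)
  then have "Suc k \<le> count_list (word z 0 (n + N + 1)) e"
    using y(2) by simp
  then show ?case using z(1) by blast
qed

lemma spread_unbounded:
  assumes not_singleton: "\<And>x. X \<noteq> {x}"
  shows "\<exists>n. C < max_zeros X n - min_zeros X n"
proof (rule ccontr)
  let ?d = "\<lambda>n. max_zeros X n - min_zeros X n"
  assume "\<not> ?thesis"
  then have "finite (range ?d)"
    by (auto intro!: finite_subset[of _ "{..C}"] simp: not_less)
  then have "Max (range ?d) \<in> range ?d"
    by (intro Max_in) auto
  then obtain m where "Max (range ?d) = ?d m"
    by (rule rangeE)
  then have max: "?d n \<le> ?d m" for n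
    using Max_ge[OF \<open>finite (range ?d)\<close>, of "?d n"] by simp
  obtain c N where lin: "\<And>k. int (min_zeros X (N + k)) = int (min_zeros X N) + int k * c"
    using min_zeros_eventually_linear[OF max] by blast
  \<comment> \<open>If one letter never occurred, \<open>X\<close> would consist of a single
    constant sequence.\<close>
  have occurs: "\<exists>x\<in>X. \<exists>i. x i = e" if e: "e = 0 \<or> e = 1" for e
  proof (rule ccontr)
    assume avoid: "\<not> ?thesis"
    have "x = (\<lambda>_. 1 - e)" if "x \<in> X" for x
    proof
      fix i
      show "x i = 1 - e"
        using letter_binary[OF that, of i] e avoid that by auto
    qed
    then have "X = {\<lambda>_. 1 - e}"
      using nonempty by blast
    then show False
      using not_singleton by blast
  qed
  consider "c < 0" | "c = 0" | "c = 1" | "c \<ge> 2" by linarith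
  then show False
  proof cases
    case 1
    \<comment> \<open>After \<open>min_zeros X N + 1\<close> steps of slope at most
      \<open>-1\<close> the minimum would be negative.\<close>
    then have "(int (min_zeros X N) + 1) * c \<le> (int (min_zeros X N) + 1) * (-1)"
      by (intro mult_left_mono) auto
    then show False
      using lin[of "min_zeros X N + 1"] by (simp add: algebra_simps)
  next
    case 2
    \<comment> \<open>Windows shorter than \<open>N\<close> have fewer than \<open>N\<close> zeros;
      longer ones have at most \<open>a N + d m\<close>, as \<open>a\<close> is constant from
      \<open>N\<close> on.\<close>
    let ?B = "N + min_zeros X N + ?d m"
    have bound: "count_list (word x 0 n) 0 \<le> ?B" if "x \<in> X" for x n
    proof (cases "n \<ge> N")
      case True
      then have "min_zeros X n = min_zeros X N"
        using lin[of "n - N"] 2 by simp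
      then show ?thesis
        using count_bounds(2)[OF that, of 0 n] max[of n] min_zeros_le_max_zeros[of n] by linarith
    next
      case False
      then show ?thesis
        using count_le_length[of "word x 0 n" 0] by simp
    qed
    obtain x i where "x \<in> X" "x i = 0"
      using occurs[of 0] by blast
    then obtain y n where "y \<in> X" "Suc ?B \<le> count_list (word y 0 n) 0"
      using letter_count_unbounded by blast
    then show False
      using bound[of y n] by linarith
  next
    case 3
    \<comment> \<open>With slope \<open>1\<close>, \<open>n - a n\<close> stays equal to
      \<open>N - a N\<close> from \<open>N\<close> on, and it bounds the number of ones.\<close>
    have bound: "count_list (word x 0 n) 1 \<le> N" if "x \<in> X" for x n
    proof (cases "n \<ge> N")
      case True
      then have "n \<le> min_zeros X n + N"
        using lin[of "n - N"] 3 by simp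
      moreover have "count_list (word x 0 n) 0 + count_list (word x 0 n) 1 = n"
        using count_list_binary language_binary[OF word_in_language[OF that, of 0 n]] by simp
      ultimately show ?thesis
        using count_bounds(1)[OF that, of n 0] by linarith
    next
      case False
      then show ?thesis
        using count_le_length[of "word x 0 n" 1] by simp
    qed
    obtain x i where "x \<in> X" "x i = 1"
      using occurs[of 1] by blast
    then obtain y n where "y \<in> X" "Suc N \<le> count_list (word y 0 n) 1"
      using letter_count_unbounded by blast
    then show False
      using bound[of y n] by linarith
  next
    case 4
    \<comment> \<open>Slope at least \<open>2\<close> for \<open>N + 1\<close> steps would give
      \<open>a (2 * N + 1) \<ge> 2 * N + 2\<close>, more zeros than letters.\<close>
    then have "int (N + 1) * 2 \<le> int (N + 1) * c"
      by (intro mult_left_mono) auto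
    then show False
      using lin[of "N + 1"] min_zeros_le[of "N + (N + 1)"] by (simp add: algebra_simps)
  qed
qed

end

theorem lemma4p18:
  fixes X :: "(int \<Rightarrow> nat) set"
  assumes "subshift X"
    and "X \<noteq> {}"
    and "\<forall>x. X \<noteq> {x}"
    and "minimal_system X shift"
    and "topologically_mixing X shift"
  shows "filterlim (\<lambda>n. real (max_zeros X n) - real (min_zeros X n)) at_top sequentially"
proof -
  interpret mixing_subshift X
    using assms by unfold_locales auto
  show ?thesis
    unfolding filterlim_at_top
  proof
    fix Z :: real
    obtain m where m: "nat \<lceil>Z\<rceil> < max_zeros X m - min_zeros X m"
      using spread_unbounded assms(3) by blast
    show "\<forall>\<^sub>F n in sequentially. Z \<le> real (max_zeros X n) - real (min_zeros X n)"
      using eventually_spread_ge[of m]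
    proof eventually_elim
      case (elim n)
      then have "real (nat \<lceil>Z\<rceil>) \<le> real (max_zeros X n - min_zeros X n)"
        using m by simp
      then show ?case
        using min_zeros_le_max_zeros[of n] by (simp add: of_nat_diff) linarith
    qed
  qed
qed

end
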